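(* Let $K$ be a compact Hausdorff space, let $A$ be a uniform algebra on $K$, let $\Gamma'$ be the set of limit points in the Shilov boundary $\Gamma$ of $A$, and let $\rho(A)$ be the set of all strong peak points for $A$. If $\rho(A)\cap\Gamma'\neq\emptyset$, then the uniform algebra $A$ has the convex diametral local diameter two property (convex-DLD2P).
   Context: A uniform algebra on a compact Hausdorff space $K$ is a closed subalgebra of $C(K)$ (complex-valued, supremum norm) that separates the points of $K$ and contains the constant functions. A boundary for $A$ is a set $S\subset K$ such that for every $\phi\in A$ there is $t\in S$ with $|\phi(t)|=\|\phi\|_\infty$; the Shilov boundary of $A$ is the smallest closed boundary of $A$. A point $t_0\in K$ is a strong peak point for $A$ if there is $\phi\in A$ such that $|\phi(t_0)|=\|\phi\|_\infty$ and $\|\phi\|_\infty>\sup\{|\phi(t)|:t\in K\setminus U\}$ for every open neighborhood $U$ of $t_0$. For a Banach space $Z$ with closed unit ball $B_Z$ and unit sphere $S_Z$, $z\in S_Z$ and $\epsilon>0$, let $\Delta_\epsilon(z)=\{y\in B_Z:\|z-y\|\ge 2-\epsilon\}$. A point $z\in S_Z$ is a $\Delta$-point if $z\in\overline{\mathrm{conv}}\,\Delta_\epsilon(z)$ for every $\epsilon>0$. $Z$ has the convex-DLD2P if $B_Z$ is the closed convex hull of the set of all $\Delta$-points of $Z$. *)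

theory Defs
  imports "HOL-Analysis.Analysis"
begin

section \<open>Uniform algebras\<close>

text \<open>
  A compact Hausdorff space is a type of class \<open>t2_space\<close> with compact \<open>UNIV\<close>; every continuous
  function on it is bounded, so that \<open>C(K)\<close> is the type \<open>'k \<Rightarrow>\<^sub>C complex\<close> with its supremum norm.
  The library only makes the latter a real normed space, hence the explicit product.
\<close>

definition bcontfun_mult ::
    "('k::topological_space \<Rightarrow>\<^sub>C complex) \<Rightarrow> ('k \<Rightarrow>\<^sub>C complex) \<Rightarrow> ('k \<Rightarrow>\<^sub>C complex)" where
  "bcontfun_mult f g = Bcontfun (\<lambda>t. f t * g t)"

lemma apply_bcontfun_mult [simp]: "bcontfun_mult f g t = f t * g t"
proof -
  have "norm (f t * g t) \<le> norm f * norm g" for t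
    by (simp add: norm_mult mult_mono norm_bounded)
  then have "(\<lambda>t. f t * g t) \<in> bcontfun"
    by (intro bcontfun_normI continuous_on_mult continuous_on_apply_bcontfun)
  then show ?thesis
    by (simp add: bcontfun_mult_def Bcontfun_inverse)
qed

definition uniform_algebra :: "('k::topological_space \<Rightarrow>\<^sub>C complex) set \<Rightarrow> bool" where
  "uniform_algebra A \<longleftrightarrow>
     closed A \<and>
     (\<forall>c. const_bcontfun c \<in> A) \<and>
     (\<forall>f\<in>A. \<forall>g\<in>A. f + g \<in> A) \<and>
     (\<forall>c. \<forall>f\<in>A. bcontfun_mult (const_bcontfun c) f \<in> A) \<and>
     (\<forall>f\<in>A. \<forall>g\<in>A. bcontfun_mult f g \<in> A) \<and>
     (\<forall>s t. s \<noteq> t \<longrightarrow> (\<exists>f\<in>A. apply_bcontfun f s \<noteq> apply_bcontfun f t))"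

definition boundary_for :: "('k::topological_space \<Rightarrow>\<^sub>C complex) set \<Rightarrow> 'k set \<Rightarrow> bool" where
  "boundary_for A S \<longleftrightarrow> (\<forall>\<phi>\<in>A. \<exists>t\<in>S. norm (apply_bcontfun \<phi> t) = norm \<phi>)"

text \<open>\<open>LEAST\<close> is taken with respect to inclusion. For a uniform algebra on a compact Hausdorff space
  the least closed boundary exists, by Shilov's theorem.\<close>

definition shilov_boundary :: "('k::topological_space \<Rightarrow>\<^sub>C complex) set \<Rightarrow> 'k set" where
  "shilov_boundary A = (LEAST S. closed S \<and> boundary_for A S)"

text \<open>The neighbourhood \<open>U = UNIV\<close> is excluded because \<open>Sup {}\<close> is unspecified on the reals; its
  condition is vacuous if the supremum of the empty set is \<open>-\<infinity>\<close>. With the convention \<open>0\<close> the same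
  points are obtained, a constant function being a witness on a one-point space.\<close>

definition strong_peak_point :: "('k::topological_space \<Rightarrow>\<^sub>C complex) set \<Rightarrow> 'k \<Rightarrow> bool" where
  "strong_peak_point A t0 \<longleftrightarrow>
     (\<exists>\<phi>\<in>A. norm (apply_bcontfun \<phi> t0) = norm \<phi> \<and>
        (\<forall>U. open U \<and> t0 \<in> U \<and> U \<noteq> UNIV \<longrightarrow> norm \<phi> > (SUP t\<in>-U. norm (apply_bcontfun \<phi> t))))"

section \<open>Delta-points\<close>

text \<open>The Banach space \<open>Z\<close> is a closed linear subspace of an ambient normed space, so closures and
  convex hulls may be formed in the ambient space.\<close>

definition Delta_set :: "'z::real_normed_vector set \<Rightarrow> real \<Rightarrow> 'z \<Rightarrow> 'z set" where
  "Delta_set Z \<epsilon> z = {y \<in> Z. norm y \<le> 1 \<and> norm (z - y) \<ge> 2 - \<epsilon>}"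

definition Delta_point :: "'z::real_normed_vector set \<Rightarrow> 'z \<Rightarrow> bool" where
  "Delta_point Z z \<longleftrightarrow>
     z \<in> Z \<and> norm z = 1 \<and> (\<forall>\<epsilon>>0. z \<in> closure (convex hull (Delta_set Z \<epsilon> z)))"

definition convex_DLD2P :: "'z::real_normed_vector set \<Rightarrow> bool" where
  "convex_DLD2P Z \<longleftrightarrow> {z \<in> Z. norm z \<le> 1} = closure (convex hull {z. Delta_point Z z})"

end

theory Submission
  imports Defs "HOL-Complex_Analysis.Complex_Analysis"
begin

text \<open>
  Composing a peaking function with \<open>z \<mapsto> 1 - (1 - z)\<^sup>\<alpha>\<close>, \<open>\<alpha>\<close> small, gives \<open>\<psi> \<in> A\<close> that is \<open>1\<close> at a given point,
  small off a given neighbourhood, and satisfies \<open>\<bar>\<psi>\<bar> + (1 - \<delta>) \<bar>1 - \<psi>\<bar> \<le> 1\<close> everywhere.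

  If \<open>\<bar>f t\<^sub>0\<bar> = \<parallel>f\<parallel> = 1\<close> at a limit point \<open>t\<^sub>0\<close> of the Shilov boundary, choose such \<open>\<psi>\<^sub>1, \<dots>, \<psi>\<^sub>N\<close> for disjoint
  open sets near \<open>t\<^sub>0\<close> that meet the Shilov boundary. The functions \<open>f (1 - 2 \<psi>\<^sub>i)\<close> have norm almost at
  most \<open>1\<close>, are almost at distance \<open>2\<close> from \<open>f\<close>, and their average tends to \<open>f\<close>, so \<open>f\<close> is a
  \<open>\<Delta>\<close>-point.

  If \<open>t\<^sub>0\<close> is moreover a strong peak point and \<open>\<parallel>f\<parallel> \<le> 1\<close>, take \<open>\<psi>\<close> at \<open>t\<^sub>0\<close> and unimodular \<open>u, v\<close> with
  \<open>u + v = 2 (1 - \<delta>) f t\<^sub>0\<close>. Then \<open>(1 - \<delta>) f (1 - \<psi>) + u \<psi>\<close> and \<open>(1 - \<delta>) f (1 - \<psi>) + v \<psi>\<close> are \<open>\<Delta>\<close>-points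
  whose mean is close to \<open>f\<close>.
\<close>

section \<open>The disk algebra and Stolz regions\<close>

text \<open>Dilation: \<open>F (r * z)\<close> with \<open>r < 1\<close> is uniformly close to
  \<open>F z\<close> by uniform continuity, and it is holomorphic on a disk larger than the closed
  unit disk, so its Taylor polynomials converge uniformly there.\<close>

lemma disk_algebra_polynomial_approx:
  fixes F :: "complex \<Rightarrow> complex"
  assumes cont: "continuous_on (cball 0 1) F" and holo: "F holomorphic_on ball 0 1" and "e > 0"
  obtains a :: "nat \<Rightarrow> complex" and n :: nat
  where "\<And>z. norm z \<le> 1 \<Longrightarrow> norm (F z - (\<Sum>i<n. a i * z ^ i)) < e"
proof -
  have "uniformly_continuous_on (cball 0 1) F"
    using cont by (simp add: compact_uniformly_continuous)
  then obtain d where "d > 0"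
    and d: "\<And>z w. norm z \<le> 1 \<Longrightarrow> norm w \<le> 1 \<Longrightarrow> dist z w < d \<Longrightarrow> dist (F z) (F w) < e / 2"
    unfolding uniformly_continuous_on_def using \<open>e > 0\<close>
    by (metis dist_0_norm half_gt_zero mem_cball)
  \<comment> \<open>The inner minimum with \<open>1 / 2\<close> keeps \<open>r\<close>
    positive.\<close>
  define r where "r = 1 - min (d / 2) (1 / 2)"
  have r: "0 < r" "r < 1" "1 - r < d"
    using \<open>d > 0\<close> by (auto simp: r_def min_def)
  define G where "G = (\<lambda>z. F (of_real r * z))"
  have G: "dist (F z) (G z) < e / 2" if "norm z \<le> 1" for z
  proof -
    have "dist z (of_real r * z) = norm (of_real (1 - r) * z)"
      by (simp add: dist_norm algebra_simps)
    also have "\<dots> \<le> 1 - r"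
      using r that by (simp only: norm_mult norm_of_real) (simp add: mult_left_le)
    finally have "dist z (of_real r * z) < d"
      using r by simp
    moreover have "norm (of_real r * z) \<le> 1"
      using r that by (simp add: norm_mult mult_le_one)
    ultimately show ?thesis
      using d[OF that] by (simp add: G_def)
  qed
  have hG: "G holomorphic_on ball 0 (1 / r)"
  proof -
    have "(F \<circ> (\<lambda>z. of_real r * z)) holomorphic_on ball 0 (1 / r)"
      using holo r by (intro holomorphic_on_compose_gen[where t = "ball 0 1"])
        (auto intro!: holomorphic_intros simp: norm_mult field_simps)
    then show ?thesis
      by (simp add: G_def o_def)
  qed
  define a where "a i = (deriv ^^ i) G 0 / fact i" for i
  have sums: "(\<lambda>i. a i * z ^ i) sums G z" if "norm z < 1 / r" for z
    using holomorphic_power_series[OF hG, of z] that by (simp add: a_def)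
  \<comment> \<open>Convergence at a single point of modulus strictly between \<open>1\<close> and
    \<open>1 / r\<close> forces a radius of convergence above \<open>1\<close>, hence uniform
    convergence on the closed unit disk.\<close>
  define \<rho> where "\<rho> = (1 + 1 / r) / 2"
  have \<rho>: "1 < \<rho>" "\<rho> < 1 / r"
    using r by (auto simp: \<rho>_def field_simps)
  have "conv_radius a \<ge> norm (of_real \<rho> :: complex)"
    using sums[of "of_real \<rho>"] \<rho> by (intro conv_radius_geI) (auto simp: sums_iff)
  then have "ereal \<rho> \<le> conv_radius a"
    using \<rho> by simp
  then have "ereal 1 < conv_radius a"
    using \<rho> by (metis ereal_less_eq(3) less_le_trans not_le)
  from powser_uniform_limit[OF this, of 0]
  have "uniform_limit (cball 0 1) (\<lambda>n z. \<Sum>i<n. a i * z ^ i) (\<lambda>z. \<Sum>i. a i * z ^ i) sequentially"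
    by simp
  then have "\<forall>\<^sub>F n in sequentially. \<forall>z\<in>cball 0 1. dist (\<Sum>i<n. a i * z ^ i) (\<Sum>i. a i * z ^ i) < e / 2"
    using \<open>e > 0\<close> by (intro uniform_limitD) auto
  then obtain n where n: "\<And>z. norm z \<le> 1 \<Longrightarrow> dist (\<Sum>i<n. a i * z ^ i) (\<Sum>i. a i * z ^ i) < e / 2"
    unfolding eventually_sequentially by (meson le_refl mem_cball_0)
  have "norm (F z - (\<Sum>i<n. a i * z ^ i)) < e" if z: "norm z \<le> 1" for z
  proof -
    have "norm z < 1 / r"
      using z \<rho> by simp
    then have "(\<Sum>i. a i * z ^ i) = G z"
      using sums by (simp add: sums_iff)
    then have "dist (\<Sum>i<n. a i * z ^ i) (G z) < e / 2"
      using n[OF z] by simp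
    then have "dist (F z) (\<Sum>i<n. a i * z ^ i) < e"
      using G[OF z] by (rule dist_triangle_half_l[rotated])
    then show ?thesis
      by (simp add: dist_norm)
  qed
  then show thesis
    using that by blast
qed

text \<open>Since \<open>1 - z\<close> lies in the closed right half-plane,
  \<open>W z = (1 - z) powr a\<close> lies in a thin sector around the positive axis with modulus at
  most \<open>2 powr a\<close>. For small \<open>a\<close> this sector fits into the region where
  \<open>norm (1 - W) + c * norm W\<close> is at most \<open>1\<close>, and
  \<open>F = 1 - W\<close>.\<close>

lemma disk_algebra_stolz_map:
  fixes \<delta> :: real
  assumes "0 < \<delta>" "\<delta> < 1"
  obtains F :: "complex \<Rightarrow> complex"
  where "continuous_on (cball 0 1) F" "F holomorphic_on ball 0 1" "F 0 = 0" "F 1 = 1"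
    "\<And>z. norm z \<le> 1 \<Longrightarrow> norm (F z) + (1 - \<delta>) * norm (1 - F z) \<le> 1"
proof -
  define c where "c = 1 - \<delta>"
  have c: "0 < c" "c < 1"
    using assms by (auto simp: c_def)
  \<comment> \<open>Squaring \<open>norm (1 - W) \<le> 1 - c * norm W\<close> and dividing by
    \<open>norm W\<close> leaves an inequality that follows from positivity of this expression; its
    limit \<open>(1 - c)\<^sup>2\<close> is positive.\<close>
  have "((\<lambda>a::real. 2 * (cos (a * pi / 2) - c) - 2 powr a * (1 - c\<^sup>2)) \<longlongrightarrow>
      2 * (cos (0 * pi / 2) - c) - 2 powr 0 * (1 - c\<^sup>2)) (at_right 0)"
    by (intro tendsto_intros) auto
  moreover have "2 * (cos (0 * pi / 2) - c) - 2 powr 0 * (1 - c\<^sup>2) = (1 - c)\<^sup>2"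
    by (simp add: power2_eq_square algebra_simps)
  ultimately have "\<forall>\<^sub>F a in at_right 0. 2 * (cos (a * pi / 2) - c) - 2 powr a * (1 - c\<^sup>2) > 0"
    using c by (intro order_tendstoD(1)[where y = "(1 - c)\<^sup>2"]) auto
  \<comment> \<open>Makes \<open>1 - c * norm W\<close> nonnegative, so that the squares can be
    removed.\<close>
  moreover have "\<forall>\<^sub>F a in at_right 0. c * 2 powr a < 1"
  proof -
    have "((\<lambda>a::real. c * 2 powr a) \<longlongrightarrow> c * 2 powr 0) (at_right 0)"
      by (intro tendsto_intros) auto
    then show ?thesis
      using c by (intro order_tendstoD(2)[where y = "c * 2 powr 0"]) auto
  qed
  moreover have "\<forall>\<^sub>F a in at_right (0::real). 0 < a \<and> a < 1"
    by (intro eventually_conj eventually_at_right_less)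
      (use eventually_at_right_real[of 0 1] in \<open>auto elim: eventually_mono\<close>)
  ultimately have "\<forall>\<^sub>F a in at_right 0. 2 * (cos (a * pi / 2) - c) - 2 powr a * (1 - c\<^sup>2) > 0
      \<and> c * 2 powr a < 1 \<and> 0 < a \<and> a < 1"
    by eventually_elim auto
  then obtain a where a: "2 * (cos (a * pi / 2) - c) - 2 powr a * (1 - c\<^sup>2) > 0"
      "c * 2 powr a < 1" "0 < a" "a < 1"
    using eventually_happens trivial_limit_at_right_real by blast
  define W where "W z = (1 - z) powr of_real a" for z :: complex
  have Re: "Re (1 - z) \<ge> 0" if "norm z \<le> 1" for z :: complex
    using that complex_Re_le_cmod[of z] by simp
  have bound: "norm (1 - W z) + c * norm (W z) \<le> 1" if z: "norm z \<le> 1" for z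
  proof (cases "z = 1")
    case True
    then show ?thesis by (simp add: W_def)
  next
    case False
    define \<rho> where "\<rho> = norm (W z)"
    have \<rho>_eq: "\<rho> = norm (1 - z) powr a"
      by (simp add: \<rho>_def W_def norm_powr_real_powr')
    have "norm (1 - z) \<le> 2"
      using norm_triangle_ineq4[of 1 z] z by simp
    then have \<rho>: "\<rho> \<le> 2 powr a" "\<rho> \<ge> 0"
      using a by (auto simp: \<rho>_eq intro: powr_mono2)
    have "\<bar>Im (Ln (1 - z))\<bar> \<le> pi / 2"
      using Re[OF z] False Re_Ln_pos_le[of "1 - z"] by simp
    then have ang: "\<bar>a * Im (Ln (1 - z))\<bar> \<le> a * pi / 2"
      using a by (simp add: abs_mult)
    have "a * pi / 2 \<le> pi"
      using a by simp
    then have "cos (a * pi / 2) \<le> cos \<bar>a * Im (Ln (1 - z))\<bar>"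
      using ang by (intro cos_monotone_0_pi_le) auto
    moreover have "Re (W z) = \<rho> * cos (a * Im (Ln (1 - z)))"
      using False by (simp add: W_def \<rho>_def powr_def Re_exp)
    ultimately have ReW: "Re (W z) \<ge> \<rho> * cos (a * pi / 2)"
      using \<rho> by (simp add: mult_left_mono)
    have "\<rho> * (2 powr a * (1 - c\<^sup>2)) \<ge> \<rho> * (\<rho> * (1 - c\<^sup>2))"
      using \<rho> c by (intro mult_left_mono mult_right_mono) (auto simp: power_le_one)
    moreover have "\<rho> * (2 powr a * (1 - c\<^sup>2)) \<le> \<rho> * (2 * (cos (a * pi / 2) - c))"
      using \<rho> a by (intro mult_left_mono) auto
    ultimately have key: "\<rho> * (\<rho> * (1 - c\<^sup>2)) \<le> 2 * (\<rho> * cos (a * pi / 2)) - 2 * c * \<rho>"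
      by (simp add: algebra_simps)
    have "(norm (1 - W z))\<^sup>2 = 1 - 2 * Re (W z) + \<rho>\<^sup>2"
      unfolding \<rho>_def cmod_power2 by (simp add: power2_eq_square algebra_simps)
    also have "\<dots> \<le> (1 - c * \<rho>)\<^sup>2"
      using key ReW by (simp add: power2_eq_square algebra_simps)
    finally have "(norm (1 - W z))\<^sup>2 \<le> (1 - c * \<rho>)\<^sup>2" .
    moreover have "c * \<rho> \<le> 1"
      using mult_left_mono[of \<rho> "2 powr a" c] \<rho> c a(2) by linarith
    then have "0 \<le> 1 - c * \<rho>"
      by linarith
    ultimately have "norm (1 - W z) \<le> 1 - c * \<rho>"
      by (rule power2_le_imp_le)
    then show ?thesis
      by (simp add: \<rho>_def)
  qed
  show thesis
  proof
    show "continuous_on (cball 0 1) (\<lambda>z. 1 - W z)"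
      unfolding W_def using Re a by (intro continuous_intros) auto
    have "1 - z \<notin> \<real>\<^sub>\<le>\<^sub>0" if "norm z < 1" for z :: complex
      using that complex_Re_le_cmod[of z] by (auto simp: complex_nonpos_Reals_iff)
    then show "(\<lambda>z. 1 - W z) holomorphic_on ball 0 1"
      unfolding W_def by (intro holomorphic_intros) auto
    show "norm (1 - W z) + (1 - \<delta>) * norm (1 - (1 - W z)) \<le> 1" if "norm z \<le> 1" for z
      using bound[OF that] by (simp add: c_def)
  qed (use a in \<open>auto simp: W_def\<close>)
qed

text \<open>Write \<open>1 - 2 * z\<close> as \<open>(1 - z) - z\<close>: the hypothesis bounds the
  sum of the two moduli by \<open>1 + \<delta> * norm (1 - z)\<close>. Multiplication by
  \<open>1 - 2 * \<psi>\<close> is thus almost contractive.\<close>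

lemma stolz_region_bounds:
  fixes z :: complex
  assumes "norm z + (1 - \<delta>) * norm (1 - z) \<le> 1" "0 < \<delta>" "\<delta> < 1"
  shows "norm z \<le> 1" "norm (1 - 2 * z) \<le> 1 + 2 * \<delta>"
proof -
  have "0 \<le> (1 - \<delta>) * norm (1 - z)"
    using assms by simp
  then show le1: "norm z \<le> 1"
    using assms(1) by linarith
  have "norm (1 - 2 * z) \<le> norm (1 - z) + norm z"
    using norm_triangle_ineq4[of "1 - z" z] by (simp add: algebra_simps)
  also have "\<dots> \<le> 1 + \<delta> * norm (1 - z)"
    using assms(1) by (simp add: algebra_simps)
  also have "\<delta> * norm (1 - z) \<le> \<delta> * 2"
    using norm_triangle_ineq4[of 1 z] le1 assms by (intro mult_left_mono) auto
  finally show "norm (1 - 2 * z) \<le> 1 + 2 * \<delta>"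
    by (simp add: mult.commute)
qed

section \<open>Compactness, unimodular means and disjoint neighbourhoods\<close>

lemma compact_norm_bound_less_one:
  fixes \<phi> :: "'a::topological_space \<Rightarrow> complex"
  assumes "compact C" "continuous_on C \<phi>" "\<And>x. x \<in> C \<Longrightarrow> norm (\<phi> x) < 1"
  obtains m where "0 \<le> m" "m < 1" "\<And>x. x \<in> C \<Longrightarrow> norm (\<phi> x) \<le> m"
proof (cases "C = {}")
  case False
  have "continuous_on C (\<lambda>x. norm (\<phi> x))"
    by (intro continuous_intros assms)
  then obtain y where "y \<in> C" "\<And>x. x \<in> C \<Longrightarrow> norm (\<phi> x) \<le> norm (\<phi> y)"
    using continuous_attains_sup[OF assms(1) False] by blast
  then show thesis
    using that[of "norm (\<phi> y)"] assms(3) by auto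
qed (use that[of 0] in auto)

text \<open>For \<open>r = norm b\<close> the point of the unit circle with real part
  \<open>r\<close> and its conjugate have mean \<open>r\<close>; rotating both by the phase of
  \<open>b\<close> gives \<open>u\<close> and \<open>v\<close>.\<close>

lemma unimodular_average:
  fixes b :: complex
  assumes "norm b \<le> 1"
  obtains u v where "norm u = 1" "norm v = 1" "u + v = 2 * b"
proof -
  define r where "r = norm b"
  define u where "u = (if b = 0 then 1 else sgn b)"
  define w where "w = Complex r (sqrt (1 - r\<^sup>2))"
  have r: "0 \<le> r" "r\<^sup>2 \<le> 1"
    using assms by (auto simp: r_def power_le_one)
  have "norm w = 1"
    using r by (simp add: w_def complex_norm)
  moreover have "norm u = 1"
    by (simp add: u_def norm_sgn)
  moreover have "u * w + u * cnj w = 2 * b"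
  proof -
    have "w + cnj w = 2 * of_real r"
      by (simp add: w_def complex_eq_iff)
    moreover have "u * of_real r = b"
      by (simp add: u_def r_def sgn_div_norm scaleR_conv_of_real)
    ultimately show ?thesis
      by (metis distrib_left mult.left_commute)
  qed
  ultimately show thesis
    by (intro that[of "u * w" "u * cnj w"]) (simp_all add: norm_mult)
qed

text \<open>Pick a point of \<open>S\<close> other than \<open>t0\<close> in \<open>U\<close>,
  separate it from \<open>t0\<close>, keep its neighbourhood, and continue inside the neighbourhood
  of \<open>t0\<close>. This is why the induction has to vary \<open>U\<close>.\<close>

lemma islimpt_disjoint_open_sets:
  fixes t0 :: "'a::t2_space"
  assumes "t0 islimpt S" "open U" "t0 \<in> U"
  obtains W :: "nat \<Rightarrow> 'a set"
  where "\<And>i. i < n \<Longrightarrow> open (W i)" "\<And>i. i < n \<Longrightarrow> W i \<subseteq> U" "\<And>i. i < n \<Longrightarrow> W i \<inter> S \<noteq> {}"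
    "disjoint_family_on W {..<n}"
proof -
  have "\<exists>W. (\<forall>i<n. open (W i) \<and> W i \<subseteq> U \<and> W i \<inter> S \<noteq> {}) \<and> disjoint_family_on W {..<n}"
    using assms(2,3)
  proof (induction n arbitrary: U)
    case 0
    show ?case
      by (simp add: disjoint_family_on_def)
  next
    case (Suc n)
    obtain t where t: "t \<in> S" "t \<in> U" "t \<noteq> t0"
      using assms(1) Suc.prems unfolding islimpt_def by blast
    obtain P Q where PQ: "open P" "open Q" "t \<in> P" "t0 \<in> Q" "P \<inter> Q = {}"
      using hausdorff[OF t(3)] by blast
    obtain W where W: "\<And>i. i < n \<Longrightarrow> open (W i) \<and> W i \<subseteq> U \<inter> Q \<and> W i \<inter> S \<noteq> {}"
      and disj: "disjoint_family_on W {..<n}"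
      using Suc.IH[of "U \<inter> Q"] Suc.prems PQ by (metis IntI open_Int)
    define W' where "W' = W(n := U \<inter> P)"
    have "open (W' i) \<and> W' i \<subseteq> U \<and> W' i \<inter> S \<noteq> {}" if "i < Suc n" for i
    proof (cases "i = n")
      case True
      have "open (U \<inter> P)"
        using Suc.prems PQ by (intro open_Int)
      then show ?thesis
        using True t PQ by (auto simp: W'_def)
    next
      case False
      then show ?thesis
        using W[of i] that by (auto simp: W'_def)
    qed
    moreover have "disjoint_family_on W' {..<Suc n}"
    proof -
      have "W' i \<inter> W' j = {}" if "i < j" "j < Suc n" for i j
      proof (cases "j = n")
        case True
        then show ?thesis
          using W[of i] that PQ(5) by (auto simp: W'_def)
      next
        case False
        then show ?thesis
          using disj that by (auto simp: W'_def disjoint_family_on_def)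
      qed
      then show ?thesis
        unfolding disjoint_family_on_def by (metis Int_commute lessThan_iff linorder_neqE_nat)
    qed
    ultimately show ?case
      by blast
  qed
  then show thesis
    using that by blast
qed

section \<open>Functional calculus and peaking functions\<close>

locale compact_uniform_algebra =
  fixes A :: "('k::t2_space \<Rightarrow>\<^sub>C complex) set"
  assumes compact_space: "compact (UNIV :: 'k set)"
    and algebra: "uniform_algebra A"
begin

text \<open>With plain functions, products, quotients and compositions can be written
  pointwise.\<close>

abbreviation fun_algebra :: "('k \<Rightarrow> complex) set" where
  "fun_algebra \<equiv> apply_bcontfun ` A"

lemma fun_algebra_continuous: "f \<in> fun_algebra \<Longrightarrow> continuous_on S f"
  by auto

lemma fun_algebra_bounded:
  assumes "f \<in> fun_algebra"
  obtains B where "0 \<le> B" "\<And>x. norm (f x) \<le> B"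
  using assms norm_bounded norm_ge_zero by (metis imageE)

lemma fun_algebra_const: "(\<lambda>_. c) \<in> fun_algebra"
proof
  show "(\<lambda>_. c) = apply_bcontfun (const_bcontfun c)" by simp
  show "const_bcontfun c \<in> A"
    using algebra by (simp add: uniform_algebra_def)
qed

lemma fun_algebra_add: "f \<in> fun_algebra \<Longrightarrow> g \<in> fun_algebra \<Longrightarrow> (\<lambda>x. f x + g x) \<in> fun_algebra"
proof safe
  fix f g assume "f \<in> A" "g \<in> A"
  then show "(\<lambda>x. apply_bcontfun f x + apply_bcontfun g x) \<in> fun_algebra"
    using algebra by (intro image_eqI[of _ _ "f + g"]) (auto simp: uniform_algebra_def)
qed

lemma fun_algebra_mult: "f \<in> fun_algebra \<Longrightarrow> g \<in> fun_algebra \<Longrightarrow> (\<lambda>x. f x * g x) \<in> fun_algebra"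
proof safe
  fix f g assume "f \<in> A" "g \<in> A"
  then show "(\<lambda>x. apply_bcontfun f x * apply_bcontfun g x) \<in> fun_algebra"
    using algebra by (intro image_eqI[of _ _ "bcontfun_mult f g"]) (auto simp: uniform_algebra_def)
qed

lemma fun_algebra_diff: "f \<in> fun_algebra \<Longrightarrow> g \<in> fun_algebra \<Longrightarrow> (\<lambda>x. f x - g x) \<in> fun_algebra"
  using fun_algebra_add[of f "\<lambda>x. (-1) * g x"] fun_algebra_mult[OF fun_algebra_const[of "-1"], of g] by simp

lemma fun_algebra_divide: "f \<in> fun_algebra \<Longrightarrow> (\<lambda>x. f x / c) \<in> fun_algebra"
  using fun_algebra_mult[OF _ fun_algebra_const[of "inverse c"], of f] by (simp add: field_simps)

lemma fun_algebra_power: "f \<in> fun_algebra \<Longrightarrow> (\<lambda>x. f x ^ n) \<in> fun_algebra"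
  by (induction n) (auto intro: fun_algebra_mult fun_algebra_const)

lemma fun_algebra_sum: "(\<And>i. i \<in> I \<Longrightarrow> f i \<in> fun_algebra) \<Longrightarrow> (\<lambda>x. \<Sum>i\<in>I. f i x) \<in> fun_algebra"
  by (induction I rule: infinite_finite_induct) (auto intro: fun_algebra_add fun_algebra_const)

text \<open>A uniform limit of bounded continuous functions is again one, and convergence then holds
  in the supremum norm, in which \<open>A\<close> is closed.\<close>

lemma fun_algebra_uniform_closure:
  assumes "\<And>e. e > 0 \<Longrightarrow> \<exists>f\<in>fun_algebra. \<forall>x. norm (g x - f x) < e"
  shows "g \<in> fun_algebra"
proof -
  have "\<exists>f\<in>A. \<forall>x. norm (g x - apply_bcontfun f x) < inverse (real (Suc n))" for n
    using assms[of "inverse (real (Suc n))"] by auto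
  then obtain f where f: "\<And>n. f n \<in> A"
    "\<And>n x. norm (g x - apply_bcontfun (f n) x) < inverse (real (Suc n))"
    by metis
  have "uniform_limit UNIV (\<lambda>n. apply_bcontfun (f n)) g sequentially"
  proof (rule uniform_limitI)
    fix e :: real assume "e > 0"
    then obtain N where N: "inverse (real (Suc N)) < e"
      using reals_Archimedean by blast
    have "\<forall>x. dist (apply_bcontfun (f n) x) (g x) < e" if "n \<ge> N" for n
    proof
      fix x
      have "inverse (real (Suc n)) \<le> inverse (real (Suc N))"
        using that by (simp add: field_simps)
      then have "norm (g x - apply_bcontfun (f n) x) < e"
        using f(2)[of x n] N by linarith
      then show "dist (apply_bcontfun (f n) x) (g x) < e"
        by (simp add: dist_norm norm_minus_commute)
    qed
    then show "\<forall>\<^sub>F n in sequentially. \<forall>x\<in>UNIV. dist (apply_bcontfun (f n) x) (g x) < e"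
      by (auto simp: eventually_sequentially)
  qed
  then obtain l where l: "g = apply_bcontfun l" "f \<longlonglongrightarrow> l"
    by (rule uniform_limit_bcontfunE) auto
  then have "l \<in> A"
    using f(1) algebra by (auto simp: uniform_algebra_def intro: closed_sequentially)
  then show ?thesis
    using l by blast
qed

text \<open>Polynomials in \<open>\<phi>\<close> belong to the algebra, and they approximate
  \<open>F\<close> of \<open>\<phi>\<close> uniformly because \<open>\<phi>\<close> takes values in
  the closed disk.\<close>

lemma fun_algebra_disk_algebra_comp:
  assumes "\<phi> \<in> fun_algebra" and "\<And>t. norm (\<phi> t) \<le> 1"
    and "continuous_on (cball 0 1) F" "F holomorphic_on ball 0 1"
  shows "(\<lambda>t. F (\<phi> t)) \<in> fun_algebra"
proof (rule fun_algebra_uniform_closure)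
  fix e :: real assume "e > 0"
  then obtain a :: "nat \<Rightarrow> complex" and n
    where "\<And>z. norm z \<le> 1 \<Longrightarrow> norm (F z - (\<Sum>i<n. a i * z ^ i)) < e"
    using disk_algebra_polynomial_approx assms(3,4) by blast
  then have "\<forall>t. norm (F (\<phi> t) - (\<Sum>i<n. a i * \<phi> t ^ i)) < e"
    using assms(2) by blast
  moreover have "(\<lambda>t. \<Sum>i<n. a i * \<phi> t ^ i) \<in> fun_algebra"
    by (intro fun_algebra_sum fun_algebra_mult fun_algebra_const fun_algebra_power assms(1))
  ultimately show "\<exists>f\<in>fun_algebra. \<forall>t. norm (F (\<phi> t) - f t) < e"
    by (rule bexI[of _ "\<lambda>t. \<Sum>i<n. a i * \<phi> t ^ i"])
qed

section \<open>Peaking functions\<close>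

text \<open>The last condition forces \<open>s\<close> into \<open>V\<close>. The first excludes the
  zero function when \<open>V\<close> is the whole space, and allows division by
  \<open>\<phi> s\<close>.\<close>

definition peaks_at_in :: "('k \<Rightarrow> complex) \<Rightarrow> 'k \<Rightarrow> 'k set \<Rightarrow> bool" where
  "peaks_at_in \<phi> s V \<longleftrightarrow>
     \<phi> s \<noteq> 0 \<and> (\<forall>x. norm (\<phi> x) \<le> norm (\<phi> s)) \<and> (\<forall>x. x \<notin> V \<longrightarrow> norm (\<phi> x) < norm (\<phi> s))"

lemma peaks_at_in_normalise:
  assumes "\<phi> \<in> fun_algebra" "peaks_at_in \<phi> s V"
  obtains \<theta> where "\<theta> \<in> fun_algebra" "\<theta> s = 1" "\<And>x. norm (\<theta> x) \<le> 1" "\<And>x. x \<notin> V \<Longrightarrow> norm (\<theta> x) < 1"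
proof
  show "(\<lambda>x. \<phi> x / \<phi> s) \<in> fun_algebra"
    by (intro fun_algebra_divide assms)
qed (use assms(2) in \<open>auto simp: peaks_at_in_def norm_divide divide_le_eq_1\<close>)

text \<open>After normalisation the function has modulus at most some \<open>m < 1\<close> on the
  compact complement of \<open>V\<close>, so a high power is close to \<open>0\<close> there while
  it stays \<open>1\<close> at \<open>s\<close>. Composition with the Stolz map \<open>F\<close>
  preserves both features, by \<open>F 0 = 0\<close>, continuity and \<open>F 1 = 1\<close>.\<close>

lemma stolz_peak_function:
  assumes "\<phi> \<in> fun_algebra" "open V" "peaks_at_in \<phi> s V" "0 < \<delta>" "\<delta> < 1" "\<eta> > 0"
  obtains \<psi> where "\<psi> \<in> fun_algebra" "\<psi> s = 1"
    "\<And>t. norm (\<psi> t) + (1 - \<delta>) * norm (1 - \<psi> t) \<le> 1" "\<And>t. t \<notin> V \<Longrightarrow> norm (\<psi> t) < \<eta>"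
proof -
  obtain \<theta> where \<theta>: "\<theta> \<in> fun_algebra" "\<theta> s = 1" "\<And>x. norm (\<theta> x) \<le> 1"
      "\<And>x. x \<notin> V \<Longrightarrow> norm (\<theta> x) < 1"
    using peaks_at_in_normalise assms by blast
  have "compact (- V)"
    using compact_space assms(2) compact_Int_closed[of UNIV "- V"] by auto
  then obtain m where m: "0 \<le> m" "m < 1" "\<And>x. x \<notin> V \<Longrightarrow> norm (\<theta> x) \<le> m"
    using compact_norm_bound_less_one[of "- V" \<theta>] \<theta> fun_algebra_continuous by auto
  obtain F where F: "continuous_on (cball 0 1) F" "F holomorphic_on ball 0 1" "F 0 = 0" "F 1 = 1"
    "\<And>z. norm z \<le> 1 \<Longrightarrow> norm (F z) + (1 - \<delta>) * norm (1 - F z) \<le> 1"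
    using disk_algebra_stolz_map assms by blast
  have "(0 :: complex) \<in> cball 0 1"
    by simp
  then obtain d where d: "d > 0" "\<forall>z\<in>cball 0 1. dist z 0 < d \<longrightarrow> dist (F z) (F 0) < \<eta>"
    using F(1)[unfolded continuous_on_iff] assms(6) by blast
  obtain n where n: "m ^ n < d"
    using real_arch_pow_inv[OF d(1) m(2)] by blast
  have le1: "norm (\<theta> t ^ n) \<le> 1" for t
    using \<theta> by (simp add: norm_power power_le_one)
  show thesis
  proof (rule that[of "\<lambda>t. F (\<theta> t ^ n)"])
    show "(\<lambda>t. F (\<theta> t ^ n)) \<in> fun_algebra"
      by (rule fun_algebra_disk_algebra_comp[OF fun_algebra_power[OF \<theta>(1)] le1 F(1,2)])
    show "norm (F (\<theta> t ^ n)) < \<eta>" if "t \<notin> V" for t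
    proof -
      have "norm (\<theta> t) ^ n \<le> m ^ n"
        using m that by (intro power_mono) auto
      then have "norm (\<theta> t ^ n) < d"
        using n by (simp add: norm_power)
      then show ?thesis
        using d(2) le1[of t] F(3) by simp
    qed
    show "F (\<theta> s ^ n) = 1"
      using \<theta> F by simp
    show "norm (F (\<theta> t ^ n)) + (1 - \<delta>) * norm (1 - F (\<theta> t ^ n)) \<le> 1" for t
      by (intro F(5) le1)
  qed
qed

section \<open>The Shilov boundary\<close>

lemma fun_algebra_attains_sup:
  assumes "f \<in> fun_algebra"
  obtains s where "\<And>x. norm (f x) \<le> norm (f s)"
proof -
  have "continuous_on UNIV (\<lambda>x. norm (f x))"
    by (intro continuous_intros fun_algebra_continuous assms)
  then show thesis
    using continuous_attains_sup[OF compact_space, of "\<lambda>x. norm (f x)"] that by blast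
qed

lemma boundary_for_iff:
  "boundary_for A S \<longleftrightarrow> (\<forall>f\<in>fun_algebra. \<exists>s\<in>S. \<forall>x. norm (f x) \<le> norm (f s))"
proof -
  have "norm (apply_bcontfun \<phi> s) = norm \<phi> \<longleftrightarrow>
      (\<forall>x. norm (apply_bcontfun \<phi> x) \<le> norm (apply_bcontfun \<phi> s))" for \<phi> :: "'k \<Rightarrow>\<^sub>C complex" and s
    by (metis antisym norm_bound norm_bounded)
  then show ?thesis
    by (simp add: boundary_for_def)
qed

text \<open>By compactness the topology of the space is the weak topology induced by
  \<open>A\<close>: separation gives, for each \<open>s\<close> outside \<open>V\<close>, a function
  vanishing at \<open>t\<close> and of modulus above \<open>1\<close> at \<open>s\<close>, and
  finitely many of these suffice.\<close>

lemma neighbourhood_basis: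
  assumes "open V" "t \<in> V"
  obtains H where "finite H" "H \<subseteq> fun_algebra" "\<And>h. h \<in> H \<Longrightarrow> h t = 0"
    "{x. \<forall>h\<in>H. norm (h x) < 1} \<subseteq> V"
proof -
  define C where "C = {h \<in> fun_algebra. h t = 0}"
  have "\<exists>h\<in>C. norm (h s) > 1" if "s \<notin> V" for s
  proof -
    have "s \<noteq> t"
      using that assms by auto
    then obtain f where f: "f \<in> fun_algebra" "f s \<noteq> f t"
      using algebra unfolding uniform_algebra_def by blast
    \<comment> \<open>The quotient is \<open>1\<close> at \<open>s\<close>; the factor
      \<open>2\<close> makes the inequality strict, so the sets in the cover are open.\<close>
    have "(\<lambda>x. 2 * ((f x - f t) / (f s - f t))) \<in> fun_algebra"
      by (intro fun_algebra_mult fun_algebra_divide fun_algebra_diff fun_algebra_const f)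
    then show ?thesis
      using f(2) by (intro bexI[of _ "\<lambda>x. 2 * ((f x - f t) / (f s - f t))"]) (auto simp: C_def)
  qed
  then have cover: "- V \<subseteq> (\<Union>h\<in>C. {x. norm (h x) > 1})"
    by auto
  have opn: "open {x. norm (h x) > 1}" if "h \<in> C" for h
    using that unfolding C_def
    by (intro open_Collect_less continuous_intros fun_algebra_continuous) auto
  have "compact (- V)"
    using compact_space assms(1) compact_Int_closed[of UNIV "- V"] by auto
  then obtain H where H: "H \<subseteq> C" "finite H" "- V \<subseteq> (\<Union>h\<in>H. {x. norm (h x) > 1})"
    using opn cover by (rule compactE_image)
  show thesis
  proof
    show "{x. \<forall>h\<in>H. norm (h x) < 1} \<subseteq> V"
      using H(3) by force
  qed (use H C_def in auto)
qed

text \<open>If some function had all its maxima on \<open>E\<close> inside \<open>W\<close>, a high power of it times each of the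
  functions cutting out \<open>W\<close> would have norm less than one, so that it would peak inside \<open>V\<close>.\<close>

lemma removable_neighbourhood:
  assumes "open V" "t \<in> V" and no_peak: "\<And>f s. f \<in> fun_algebra \<Longrightarrow> \<not> peaks_at_in f s V"
  obtains W where "open W" "t \<in> W"
    "\<And>E. closed E \<Longrightarrow> boundary_for A E \<Longrightarrow> boundary_for A (E - W)"
proof -
  obtain H where H: "finite H" "H \<subseteq> fun_algebra" "\<And>h. h \<in> H \<Longrightarrow> h t = 0"
      "{x. \<forall>h\<in>H. norm (h x) < 1} \<subseteq> V"
    using neighbourhood_basis[OF assms(1,2)] by blast
  define W where "W = {x. \<forall>h\<in>H. norm (h x) < 1}"
  have "open W"
  proof -
    have "open {x. norm (h x) < 1}" if "h \<in> H" for h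
      using that H(2) by (intro open_Collect_less continuous_intros fun_algebra_continuous) auto
    then have "open (\<Inter>h\<in>H. {x. norm (h x) < 1})"
      using H(1) by (intro open_INT) auto
    moreover have "(\<Inter>h\<in>H. {x. norm (h x) < 1}) = W"
      by (auto simp: W_def)
    ultimately show ?thesis
      by simp
  qed
  moreover have "t \<in> W"
  proof -
    have "norm (h t) < 1" if "h \<in> H" for h
      using H(3)[OF that] by simp
    then show ?thesis
      unfolding W_def by blast
  qed
  moreover have "boundary_for A (E - W)" if E: "closed E" "boundary_for A E" for E
  proof (rule ccontr)
    assume "\<not> boundary_for A (E - W)"
    then obtain f where f: "f \<in> fun_algebra" "\<And>s. s \<in> E - W \<Longrightarrow> \<exists>x. norm (f s) < norm (f x)"
      unfolding boundary_for_iff by (meson not_le)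
    \<comment> \<open>If \<open>E - W\<close> is empty, \<open>f\<close> may be zero and cannot be
      normalised; the constant \<open>1\<close> serves instead.\<close>
    have "\<exists>g s. g \<in> fun_algebra \<and> g s = 1 \<and> (\<forall>x. norm (g x) \<le> 1) \<and> (\<forall>x\<in>E - W. norm (g x) < 1)"
    proof (cases "E - W = {}")
      case True
      then show ?thesis
        using fun_algebra_const[of 1] by (intro exI[of _ "\<lambda>_. 1"]) auto
    next
      case False
      obtain s where s: "\<And>x. norm (f x) \<le> norm (f s)"
        using fun_algebra_attains_sup f(1) by blast
      have less: "norm (f x) < norm (f s)" if "x \<in> E - W" for x
        using f(2)[OF that] s by (meson less_le_trans)
      then have "f s \<noteq> 0"
        using False by fastforce
      then show ?thesis
        using s less fun_algebra_divide[OF f(1), of "f s"]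
        by (intro exI[of _ "\<lambda>x. f x / f s"] exI[of _ s]) (auto simp: norm_divide divide_le_eq_1)
    qed
    then obtain g s where g: "g \<in> fun_algebra" "g s = 1" "\<And>x. norm (g x) \<le> 1"
        "\<And>x. x \<in> E - W \<Longrightarrow> norm (g x) < 1"
      by blast
    have "closed (E - W)"
      using E(1) \<open>open W\<close> by (rule closed_Diff)
    then have "compact (E - W)"
      using compact_space compact_Int_closed[of UNIV "E - W"] by auto
    then obtain m where m: "0 \<le> m" "m < 1" "\<And>x. x \<in> E - W \<Longrightarrow> norm (g x) \<le> m"
      using compact_norm_bound_less_one[of "E - W" g] g fun_algebra_continuous by blast
    have "norm (h x) < 1" if h: "h \<in> H" and x: "norm (g x) = 1" for h x
    proof -
      obtain B where B: "0 \<le> B" "\<And>x. norm (h x) \<le> B"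
        using fun_algebra_bounded h H(2) by blast
      \<comment> \<open>Using \<open>B + 1\<close> avoids division by zero when the bound
        \<open>B\<close> is \<open>0\<close>.\<close>
      obtain n where n: "m ^ n < 1 / (B + 1)"
        using real_arch_pow_inv[of "1 / (B + 1)" m] m B by auto
      define k where "k = (\<lambda>x. g x ^ n * h x)"
      have "k \<in> fun_algebra"
        unfolding k_def using g(1) h H(2) by (intro fun_algebra_mult fun_algebra_power) auto
      \<comment> \<open>As \<open>E\<close> is a boundary, it suffices to bound \<open>k\<close> on
        \<open>E\<close>: in \<open>W\<close> the factor \<open>h\<close> is small, off
        \<open>W\<close> the power of \<open>g\<close> is.\<close>
      then obtain e where e: "e \<in> E" "\<And>x. norm (k x) \<le> norm (k e)"
        using E(2) unfolding boundary_for_iff by blast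
      have "norm (k e) < 1"
      proof (cases "e \<in> W")
        case True
        have "norm (k e) \<le> norm (h e)"
          using g(3)[of e] by (simp add: k_def norm_mult norm_power mult_left_le_one_le power_le_one)
        also have "\<dots> < 1"
          using True h by (simp add: W_def)
        finally show ?thesis .
      next
        case False
        then have "norm (g e) \<le> m"
          using m e by blast
        then have "norm (k e) \<le> m ^ n * B"
          using B m by (auto simp: k_def norm_mult norm_power intro!: mult_mono power_mono)
        also have "\<dots> \<le> m ^ n * (B + 1)"
          using m by (intro mult_left_mono) auto
        also have "\<dots> < 1"
          using n B by (simp add: field_simps)
        finally show ?thesis .
      qed
      moreover have "norm (k x) = norm (h x)"
        using x by (simp add: k_def norm_mult norm_power)
      ultimately show ?thesis
        using e(2)[of x] by linarith
    qed
    then have "norm (g x) < 1" if "x \<notin> V" for x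
      using that H(4) g(3)[of x] by (force simp: order_less_le)
    then have "peaks_at_in g s V"
      using g by (simp add: peaks_at_in_def)
    then show False
      using no_peak g(1) by blast
  qed
  ultimately show thesis
    using that by blast
qed

section \<open>Existence and description of the Shilov boundary\<close>

text \<open>An explicit candidate for the Shilov boundary, defined without reference to closed
  boundaries.\<close>

definition peak_support :: "'k set" where
  "peak_support = {t. \<forall>V. open V \<and> t \<in> V \<longrightarrow> (\<exists>f\<in>fun_algebra. \<exists>s. peaks_at_in f s V)}"

lemma closed_peak_support: "closed peak_support"
proof -
  have "open (- peak_support)"
    unfolding open_subopen[of "- peak_support"] by (auto simp: peak_support_def)
  then show ?thesis
    by (simp add: closed_def)
qed

text \<open>A point outside the closed set \<open>S\<close> would yield a function whose maximum
  modulus is attained only off \<open>S\<close>.\<close>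

lemma peak_support_subset:
  assumes "closed S" "boundary_for A S"
  shows "peak_support \<subseteq> S"
proof (rule ccontr)
  assume "\<not> peak_support \<subseteq> S"
  then obtain t where "t \<in> peak_support" "t \<notin> S"
    by blast
  then obtain f s where f: "f \<in> fun_algebra" "peaks_at_in f s (- S)"
    using assms(1) unfolding peak_support_def by blast
  obtain y where "y \<in> S" "\<And>x. norm (f x) \<le> norm (f y)"
    using assms(2) f(1) unfolding boundary_for_iff by blast
  then show False
    using f(2) by (meson ComplD leD peaks_at_in_def)
qed

text \<open>Suppose the set \<open>M\<close> of maxima of \<open>f\<close> misses
  \<open>peak_support\<close>. Every point of \<open>M\<close> then has a removable neighbourhood,
  and finitely many of them cover \<open>M\<close>. Removing these in turn from the whole space
  leaves a boundary on which \<open>f\<close> does not attain its maximum.\<close>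

lemma boundary_peak_support: "boundary_for A peak_support"
  unfolding boundary_for_iff
proof (rule ballI, rule ccontr)
  fix f
  assume f: "f \<in> fun_algebra" and no: "\<not> (\<exists>s\<in>peak_support. \<forall>x. norm (f x) \<le> norm (f s))"
  define M where "M = {s. \<forall>x. norm (f x) \<le> norm (f s)}"
  have "\<exists>W. open W \<and> t \<in> W \<and> (\<forall>E. closed E \<longrightarrow> boundary_for A E \<longrightarrow> boundary_for A (E - W))"
    if "t \<in> M" for t
  proof -
    have "t \<notin> peak_support"
      using that no by (auto simp: M_def)
    then obtain V where "open V" "t \<in> V" "\<And>f s. f \<in> fun_algebra \<Longrightarrow> \<not> peaks_at_in f s V"
      unfolding peak_support_def by blast
    then obtain W where "open W" "t \<in> W"
        "\<And>E. closed E \<Longrightarrow> boundary_for A E \<Longrightarrow> boundary_for A (E - W)"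
      using removable_neighbourhood by metis
    then show ?thesis
      by (intro exI[of _ W]) simp
  qed
  then obtain W where W: "\<And>t. t \<in> M \<Longrightarrow> open (W t)" "\<And>t. t \<in> M \<Longrightarrow> t \<in> W t"
      "\<And>t E. t \<in> M \<Longrightarrow> closed E \<Longrightarrow> boundary_for A E \<Longrightarrow> boundary_for A (E - W t)"
    by metis
  have "closed M"
    unfolding M_def
    by (intro closed_Collect_all closed_Collect_le continuous_intros fun_algebra_continuous f)
  then have "compact M"
    using compact_space compact_Int_closed[of UNIV M] by auto
  moreover have "M \<subseteq> (\<Union>t\<in>M. W t)"
    using W(2) by blast
  ultimately obtain T where T: "T \<subseteq> M" "finite T" "M \<subseteq> (\<Union>t\<in>T. W t)"
    using W(1) compactE_image[of M M W] by metis
  \<comment> \<open>Closedness is carried along because each removal applies to closed boundaries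
    only.\<close>
  from T(2,1) have "closed (UNIV - (\<Union>t\<in>T. W t)) \<and> boundary_for A (UNIV - (\<Union>t\<in>T. W t))"
  proof (induction rule: finite_induct)
    case empty
    have "boundary_for A UNIV"
      unfolding boundary_for_iff using fun_algebra_attains_sup by (metis UNIV_I)
    then show ?case
      by simp
  next
    case (insert t T)
    have "UNIV - (\<Union>t\<in>insert t T. W t) = (UNIV - (\<Union>t\<in>T. W t)) - W t"
      by blast
    then show ?case
      using insert W(1,3)[of t] by (metis closed_Diff insert_subset)
  qed
  then obtain s where "s \<in> UNIV - (\<Union>t\<in>T. W t)" "\<And>x. norm (f x) \<le> norm (f s)"
    unfolding boundary_for_iff using f by blast
  then show False
    using T(3) by (auto simp: M_def)
qed

text \<open>This contains Shilov's theorem: a least closed boundary exists, so \<open>LEAST\<close>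
  has its intended meaning.\<close>

lemma shilov_boundary_eq_peak_support: "shilov_boundary A = peak_support"
  unfolding shilov_boundary_def
  by (rule Least_equality)
    (use closed_peak_support boundary_peak_support peak_support_subset in auto)

section \<open>Delta-points of a uniform algebra\<close>

lemma convex_algebra: "convex A"
proof (rule convexI)
  fix f g :: "'k \<Rightarrow>\<^sub>C complex" and u v :: real
  assume "f \<in> A" "g \<in> A"
  have "r *\<^sub>R h = bcontfun_mult (const_bcontfun (of_real r)) h" for r and h :: "'k \<Rightarrow>\<^sub>C complex"
    by (rule bcontfun_eqI) (simp add: scaleR_conv_of_real)
  then show "u *\<^sub>R f + v *\<^sub>R g \<in> A"
    using algebra \<open>f \<in> A\<close> \<open>g \<in> A\<close> by (simp add: uniform_algebra_def)
qed

text \<open>The position of the peak is controlled only up to \<open>V\<close>; this is enough for a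
  function that is almost of modulus one throughout \<open>V\<close>.\<close>

lemma peak_in_shilov_neighbourhood:
  assumes "open V" "V \<inter> shilov_boundary A \<noteq> {}" "0 < \<delta>" "\<delta> < 1" "\<eta> > 0"
  obtains \<psi> s where "\<psi> \<in> fun_algebra" "s \<in> V" "\<psi> s = 1"
    "\<And>t. norm (\<psi> t) + (1 - \<delta>) * norm (1 - \<psi> t) \<le> 1" "\<And>t. t \<notin> V \<Longrightarrow> norm (\<psi> t) < \<eta>"
proof -
  obtain f s where f: "f \<in> fun_algebra" "peaks_at_in f s V"
    using assms(1,2) unfolding shilov_boundary_eq_peak_support peak_support_def by blast
  have "s \<in> V"
    using f(2) unfolding peaks_at_in_def by blast
  moreover obtain \<psi> where "\<psi> \<in> fun_algebra" "\<psi> s = 1"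
    "\<And>t. norm (\<psi> t) + (1 - \<delta>) * norm (1 - \<psi> t) \<le> 1" "\<And>t. t \<notin> V \<Longrightarrow> norm (\<psi> t) < \<eta>"
    using stolz_peak_function[OF f(1) assms(1) f(2) assms(3-5)] by metis
  ultimately show thesis
    using that by blast
qed

text \<open>The point \<open>t\<close> lies in at most one \<open>W i\<close>, whose term
  contributes at most \<open>1\<close>; the remaining terms together contribute at most
  \<open>N\<close> times \<open>1 / N\<close>.\<close>

lemma sum_disjoint_peaks_le:
  fixes \<psi> :: "nat \<Rightarrow> 'k \<Rightarrow> complex"
  assumes disj: "disjoint_family_on W {..<N}" and "0 < N"
    and le1: "\<And>i. i < N \<Longrightarrow> norm (\<psi> i t) \<le> 1"
    and small: "\<And>i. i < N \<Longrightarrow> t \<notin> W i \<Longrightarrow> norm (\<psi> i t) < 1 / real N"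
  shows "norm (\<Sum>i<N. \<psi> i t) \<le> 2"
proof -
  have "norm (\<psi> i t) \<le> 1 / real N + (if t \<in> W i then 1 else 0)" if "i < N" for i
    using le1[OF that] small[OF that] by (auto intro: add_increasing)
  then have "(\<Sum>i<N. norm (\<psi> i t)) \<le> (\<Sum>i<N. 1 / real N + (if t \<in> W i then 1 else 0))"
    by (intro sum_mono) auto
  also have "\<dots> = 1 + real (card {i. i < N \<and> t \<in> W i})"
    using \<open>0 < N\<close> by (simp add: sum.distrib sum.If_cases Int_def)
  also have "card {i. i < N \<and> t \<in> W i} \<le> 1"
    using disj card_le_Suc0_iff_eq[of "{i. i < N \<and> t \<in> W i}"]
    by (auto simp: disjoint_family_on_def)
  finally show ?thesis
    using norm_sum[of "\<lambda>i. \<psi> i t" "{..<N}"] by simp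
qed

text \<open>Multiplying \<open>f\<close> by \<open>1 - 2 * \<psi> i\<close> reverses its sign at the
  peak \<open>s i\<close>, where \<open>f\<close> is almost of modulus one; this gives distance
  almost \<open>2\<close>. Since the peaks are essentially disjoint, the perturbations nearly cancel
  in an average over many of them.\<close>

lemma Delta_point_if_attains_at_limit_point:
  assumes f: "f \<in> A" "norm f = 1" and t0: "norm (apply_bcontfun f t0) = 1"
    and lim: "t0 islimpt shilov_boundary A"
  shows "Delta_point A f"
  unfolding Delta_point_def
proof (intro conjI allI impI f)
  fix \<epsilon> :: real assume "\<epsilon> > 0"
  show "f \<in> closure (convex hull Delta_set A \<epsilon> f)"
    unfolding closure_approachable
  proof (intro allI impI)
    fix \<kappa> :: real assume "\<kappa> > 0"
    obtain M where M: "inverse (real (Suc M)) < min \<epsilon> \<kappa> / 6"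
      using reals_Archimedean[of "min \<epsilon> \<kappa> / 6"] \<open>\<epsilon> > 0\<close> \<open>\<kappa> > 0\<close> by auto
    \<comment> \<open>\<open>N \<ge> 2\<close> ensures \<open>\<delta> < 1\<close>. The later
      estimates lose \<open>4 * \<delta>\<close> in the distance from \<open>f\<close> and
      \<open>6 * \<delta>\<close> in the average.\<close>
    define N where "N = M + 2"
    define \<delta> where "\<delta> = 1 / real N"
    have "\<delta> \<le> inverse (real (Suc M))"
      by (simp add: \<delta>_def N_def field_simps)
    then have \<delta>: "0 < \<delta>" "\<delta> < 1" "6 * \<delta> < \<epsilon>" "6 * \<delta> < \<kappa>"
      using M by (auto simp: \<delta>_def N_def)
    define U where "U = {x. norm (apply_bcontfun f x) > 1 - \<delta>}"
    have "open U"
      unfolding U_def by (intro open_Collect_less continuous_intros continuous_on_apply_bcontfun)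
    moreover have "t0 \<in> U"
      using t0 \<delta> by (simp add: U_def)
    ultimately obtain W where W: "\<And>i. i < N \<Longrightarrow> open (W i)" "\<And>i. i < N \<Longrightarrow> W i \<subseteq> U"
        "\<And>i. i < N \<Longrightarrow> W i \<inter> shilov_boundary A \<noteq> {}" "disjoint_family_on W {..<N}"
      using islimpt_disjoint_open_sets[OF lim] by metis
    have "\<exists>\<psi> s. \<psi> \<in> fun_algebra \<and> s \<in> W i \<and> \<psi> s = 1 \<and>
        (\<forall>t. norm (\<psi> t) + (1 - \<delta>) * norm (1 - \<psi> t) \<le> 1) \<and> (\<forall>t. t \<notin> W i \<longrightarrow> norm (\<psi> t) < \<delta>)"
      if "i < N" for i
      using peak_in_shilov_neighbourhood[OF W(1,3)[OF that] \<delta>(1,2,1)] by metis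
    then obtain \<psi> s where \<psi>: "\<And>i. i < N \<Longrightarrow> \<psi> i \<in> fun_algebra" "\<And>i. i < N \<Longrightarrow> s i \<in> W i"
        "\<And>i. i < N \<Longrightarrow> \<psi> i (s i) = 1"
        "\<And>i t. i < N \<Longrightarrow> norm (\<psi> i t) + (1 - \<delta>) * norm (1 - \<psi> i t) \<le> 1"
        "\<And>i t. i < N \<Longrightarrow> t \<notin> W i \<Longrightarrow> norm (\<psi> i t) < \<delta>"
      by metis
    \<comment> \<open>The divisor is the bound for \<open>norm (1 - 2 * \<psi> i t)\<close> and
      brings \<open>y i\<close> back into the unit ball.\<close>
    have "\<exists>y\<in>A. \<forall>t. apply_bcontfun y t = apply_bcontfun f t * (1 - 2 * \<psi> i t) / (1 + 2 * \<delta>)"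
      if "i < N" for i
    proof -
      have "(\<lambda>t. apply_bcontfun f t * (1 - 2 * \<psi> i t) / (1 + 2 * \<delta>)) \<in> fun_algebra"
        using f(1) by (intro fun_algebra_divide fun_algebra_mult fun_algebra_diff fun_algebra_const
            \<psi>(1)[OF that]) auto
      then show ?thesis
        by (auto simp: fun_eq_iff)
    qed
    then obtain y where y: "\<And>i. i < N \<Longrightarrow> y i \<in> A"
        "\<And>i t. i < N \<Longrightarrow>
          apply_bcontfun (y i) t = apply_bcontfun f t * (1 - 2 * \<psi> i t) / (1 + 2 * \<delta>)"
      by metis
    have norm_\<delta>: "norm (1 + 2 * complex_of_real \<delta>) = 1 + 2 * \<delta>"
      using \<delta> norm_of_real[of "1 + 2 * \<delta>", where 'a = complex] by simp
    have f1: "norm (apply_bcontfun f t) \<le> 1" for t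
      using norm_bounded[of f t] f(2) by simp
    have "y i \<in> Delta_set A \<epsilon> f" if i: "i < N" for i
    proof -
      have "norm (apply_bcontfun (y i) t) \<le> 1" for t
      proof -
        have "norm (apply_bcontfun f t * (1 - 2 * \<psi> i t)) \<le> 1 * (1 + 2 * \<delta>)"
          unfolding norm_mult using stolz_region_bounds(2)[OF \<psi>(4)[OF i] \<delta>(1,2)] f1
          by (intro mult_mono) auto
        then show ?thesis
          using \<delta> by (simp add: y(2)[OF i] norm_divide norm_\<delta>)
      qed
      then have "norm (y i) \<le> 1"
        by (rule norm_bound)
      moreover have "norm (f - y i) \<ge> 2 - \<epsilon>"
      proof -
        have "apply_bcontfun (f - y i) (s i) =
            apply_bcontfun f (s i) * of_real (1 + 1 / (1 + 2 * \<delta>))"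
          by (simp add: y(2)[OF i] \<psi>(3)[OF i] algebra_simps)
        then have eq: "norm (apply_bcontfun (f - y i) (s i)) =
            norm (apply_bcontfun f (s i)) * (1 + 1 / (1 + 2 * \<delta>))"
          using \<delta> by (simp only: norm_mult norm_of_real) simp
        have "1 - \<delta> \<le> norm (apply_bcontfun f (s i))"
          using \<psi>(2)[OF i] W(2)[OF i] by (auto simp: U_def)
        moreover have "2 - 2 * \<delta> \<le> 1 + 1 / (1 + 2 * \<delta>)"
        proof -
          have "(1 - 2 * \<delta>) * (1 + 2 * \<delta>) \<le> 1"
            by (simp add: algebra_simps)
          then have "1 - 2 * \<delta> \<le> 1 / (1 + 2 * \<delta>)"
            using \<delta> by (simp add: pos_le_divide_eq)
          then show ?thesis
            by linarith
        qed
        ultimately have "(1 - \<delta>) * (2 - 2 * \<delta>) \<le>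
            norm (apply_bcontfun f (s i)) * (1 + 1 / (1 + 2 * \<delta>))"
          using \<delta> by (intro mult_mono) auto
        moreover have "2 - 4 * \<delta> \<le> (1 - \<delta>) * (2 - 2 * \<delta>)"
          by (simp add: algebra_simps)
        ultimately have "2 - 4 * \<delta> \<le> norm (apply_bcontfun (f - y i) (s i))"
          using eq by linarith
        also have "\<dots> \<le> norm (f - y i)"
          by (rule norm_bounded)
        finally show ?thesis
          using \<delta> by linarith
      qed
      ultimately show ?thesis
        using y(1)[OF i] by (simp add: Delta_set_def)
    qed
    then have "(\<Sum>i<N. \<delta> *\<^sub>R y i) \<in> convex hull Delta_set A \<epsilon> f"
      using \<delta>(1) by (intro convex_sum convex_convex_hull hull_inc) (auto simp: \<delta>_def N_def)
    moreover have "dist (\<Sum>i<N. \<delta> *\<^sub>R y i) f < \<kappa>"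
    proof -
      have "norm (apply_bcontfun ((\<Sum>i<N. \<delta> *\<^sub>R y i) - f) t) \<le> 6 * \<delta>" for t
      proof -
        define c where "c = complex_of_real (1 + 2 * \<delta>)"
        define S where "S = (\<Sum>i<N. \<psi> i t)"
        have c: "norm c \<ge> 1" "c \<noteq> 0"
          using \<delta> norm_\<delta> by (auto simp: c_def)
        have "apply_bcontfun (\<Sum>i<N. g i) t = (\<Sum>i<N. apply_bcontfun (g i) t)"
          for g :: "nat \<Rightarrow> 'k \<Rightarrow>\<^sub>C complex"
          by (induction N) auto
        then have "apply_bcontfun (\<Sum>i<N. \<delta> *\<^sub>R y i) t =
            (\<Sum>i<N. of_real \<delta> * (apply_bcontfun f t * (1 - 2 * \<psi> i t) / c))"
          by (simp add: y(2) c_def scaleR_conv_of_real)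
        also have "\<dots> = of_real \<delta> * (apply_bcontfun f t * (of_nat N - 2 * S) / c)"
          by (simp add: S_def sum_subtractf sum_distrib_left[symmetric] sum_divide_distrib[symmetric])
        also have "\<dots> = apply_bcontfun f t * (of_real \<delta> * of_nat N - 2 * of_real \<delta> * S) / c"
          by (simp add: algebra_simps)
        also have "of_real \<delta> * of_nat N = complex_of_real (\<delta> * real N)"
          by simp
        also have "\<delta> * real N = 1"
          by (simp add: \<delta>_def N_def)
        \<comment> \<open>The average equals \<open>f * (1 - 2 * \<delta> * S) / c\<close>.
          Subtracting \<open>f\<close> leaves a factor \<open>1 + S\<close>, whose modulus is at
          most \<open>3\<close>.\<close>
        finally have "apply_bcontfun ((\<Sum>i<N. \<delta> *\<^sub>R y i) - f) t =
            - (2 * of_real \<delta> * (apply_bcontfun f t * (1 + S))) / c"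
          using c by (simp add: c_def field_simps)
        then have "norm (apply_bcontfun ((\<Sum>i<N. \<delta> *\<^sub>R y i) - f) t) =
            2 * \<delta> * (norm (apply_bcontfun f t) * norm (1 + S)) / norm c"
          using \<delta> by (simp add: norm_divide norm_mult)
        also have "\<dots> \<le> 2 * \<delta> * (norm (apply_bcontfun f t) * norm (1 + S)) / 1"
          using c \<delta> by (intro divide_left_mono) auto
        also have "\<dots> \<le> 2 * \<delta> * (1 * 3) / 1"
        proof -
          have "norm S \<le> 2"
            unfolding S_def using stolz_region_bounds(1)[OF \<psi>(4) \<delta>(1,2)] \<psi>(5)
            by (intro sum_disjoint_peaks_le[OF W(4)]) (auto simp: N_def \<delta>_def)
          then have "norm (1 + S) \<le> 3"
            using norm_triangle_ineq[of 1 S] by simp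
          then show ?thesis
            using f1 \<delta> by (intro divide_right_mono mult_left_mono mult_mono) auto
        qed
        finally show ?thesis
          by simp
      qed
      then have "norm ((\<Sum>i<N. \<delta> *\<^sub>R y i) - f) \<le> 6 * \<delta>"
        by (rule norm_bound)
      then show ?thesis
        using \<delta> by (simp add: dist_norm)
    qed
    ultimately show "\<exists>y\<in>convex hull Delta_set A \<epsilon> f. dist y f < \<kappa>"
      by blast
  qed
qed

section \<open>Approximation by means of two functions unimodular at a strong peak point\<close>

text \<open>Testing the strong peak condition on the complement of a single point \<open>t\<close>
  gives strict inequality at every \<open>t\<close> other than \<open>t0\<close>. The second point
  \<open>t1\<close> rules out the zero function, which would be a witness on a one-point
  space.\<close>

lemma strong_peak_point_peaks:
  assumes "strong_peak_point A t0" "t1 \<noteq> t0"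
  obtains \<phi> where "\<phi> \<in> fun_algebra" "\<And>V. t0 \<in> V \<Longrightarrow> peaks_at_in \<phi> t0 V"
proof -
  obtain \<phi> where \<phi>: "\<phi> \<in> A" "norm (apply_bcontfun \<phi> t0) = norm \<phi>"
      "\<And>U. open U \<Longrightarrow> t0 \<in> U \<Longrightarrow> U \<noteq> UNIV \<Longrightarrow> norm \<phi> > (SUP t\<in>-U. norm (apply_bcontfun \<phi> t))"
    using assms(1) unfolding strong_peak_point_def by blast
  have less: "norm (apply_bcontfun \<phi> t) < norm \<phi>" if "t \<noteq> t0" for t
    using \<phi>(3)[of "- {t}"] that by auto
  have "norm \<phi> > 0"
    using less[OF assms(2)] norm_ge_zero le_less_trans by blast
  then have "peaks_at_in (apply_bcontfun \<phi>) t0 V" if "t0 \<in> V" for V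
    using that less \<phi>(2) norm_bounded[of \<phi>] unfolding peaks_at_in_def
    by (metis norm_zero order_less_irrefl)
  then show thesis
    using \<phi>(1) that by blast
qed

text \<open>The factor \<open>1 - \<delta>\<close> on \<open>f\<close> matches the one in the Stolz
  inequality, which therefore keeps both functions in the unit ball. With \<open>a\<close> the value
  of \<open>f\<close> at \<open>t0\<close>, their mean differs from \<open>f\<close> by
  \<open>\<delta> * f + (1 - \<delta>) * (f - a) * \<psi>\<close>.\<close>

lemma average_of_functions_unimodular_at_peak:
  assumes peak: "\<phi> \<in> fun_algebra" "\<And>V. t0 \<in> V \<Longrightarrow> peaks_at_in \<phi> t0 V"
    and f: "f \<in> A" "norm f \<le> 1" and "\<epsilon> > 0"
  obtains g h where "g \<in> A" "h \<in> A" "norm g = 1" "norm h = 1"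
    "norm (apply_bcontfun g t0) = 1" "norm (apply_bcontfun h t0) = 1"
    "norm (f - (1 / 2) *\<^sub>R (g + h)) < \<epsilon>"
proof -
  define \<delta> where "\<delta> = min (1 / 2) (\<epsilon> / 4)"
  have \<delta>: "0 < \<delta>" "\<delta> < 1" "3 * \<delta> < \<epsilon>"
    using \<open>\<epsilon> > 0\<close> by (auto simp: \<delta>_def min_def)
  define a where "a = apply_bcontfun f t0"
  define V where "V = {x. norm (apply_bcontfun f x - a) < \<delta>}"
  have f1: "norm (apply_bcontfun f t) \<le> 1" for t
    using norm_bounded[of f t] f(2) by simp
  have "open V"
    unfolding V_def by (intro open_Collect_less continuous_intros continuous_on_apply_bcontfun)
  moreover have "t0 \<in> V"
    using \<delta> by (simp add: V_def a_def)
  ultimately obtain \<psi> where \<psi>: "\<psi> \<in> fun_algebra" "\<psi> t0 = 1"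
    "\<And>t. norm (\<psi> t) + (1 - \<delta>) * norm (1 - \<psi> t) \<le> 1" "\<And>t. t \<notin> V \<Longrightarrow> norm (\<psi> t) < \<delta>"
    using stolz_peak_function[OF peak(1) _ peak(2) \<delta>(1,2,1)] by metis
  have lift: "\<exists>g\<in>A. norm g = 1 \<and> norm (apply_bcontfun g t0) = 1 \<and>
      (\<forall>t. apply_bcontfun g t = of_real (1 - \<delta>) * apply_bcontfun f t * (1 - \<psi> t) + u * \<psi> t)"
    if u: "norm u = 1" for u
  proof -
    have "(\<lambda>t. of_real (1 - \<delta>) * apply_bcontfun f t * (1 - \<psi> t) + u * \<psi> t) \<in> fun_algebra"
      using f(1) by (intro fun_algebra_add fun_algebra_mult fun_algebra_diff fun_algebra_const \<psi>) auto
    then obtain g where g: "g \<in> A"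
        "\<And>t. apply_bcontfun g t = of_real (1 - \<delta>) * apply_bcontfun f t * (1 - \<psi> t) + u * \<psi> t"
      by (auto simp: fun_eq_iff)
    have "norm (apply_bcontfun g t) \<le> 1" for t
    proof -
      have "norm (apply_bcontfun g t) \<le>
          norm (of_real (1 - \<delta>) * apply_bcontfun f t * (1 - \<psi> t)) + norm (u * \<psi> t)"
        unfolding g(2) by (rule norm_triangle_ineq)
      also have "\<dots> = (1 - \<delta>) * (norm (apply_bcontfun f t) * norm (1 - \<psi> t)) + norm (\<psi> t)"
        unfolding norm_mult norm_of_real using \<delta> u by simp
      also have "\<dots> \<le> (1 - \<delta>) * (1 * norm (1 - \<psi> t)) + norm (\<psi> t)"
        using \<delta> f1 by (intro add_right_mono mult_left_mono mult_right_mono) auto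
      also have "\<dots> \<le> 1"
        using \<psi>(3)[of t] by simp
      finally show ?thesis .
    qed
    then have "norm g \<le> 1"
      by (rule norm_bound)
    moreover have "norm (apply_bcontfun g t0) = 1"
      using u by (simp add: g(2) \<psi>(2))
    ultimately show ?thesis
      using g norm_bounded[of g t0] by (intro bexI[of _ g]) auto
  qed
  have "norm (of_real (1 - \<delta>) * a) \<le> 1"
    unfolding a_def using \<delta> f1[of t0] by (simp only: norm_mult norm_of_real) (simp add: mult_le_one)
  then obtain u v where uv: "norm u = 1" "norm v = 1" "u + v = 2 * (of_real (1 - \<delta>) * a)"
    by (rule unimodular_average)
  obtain g h where gh: "g \<in> A" "norm g = 1" "norm (apply_bcontfun g t0) = 1"
      "\<And>t. apply_bcontfun g t = of_real (1 - \<delta>) * apply_bcontfun f t * (1 - \<psi> t) + u * \<psi> t"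
      "h \<in> A" "norm h = 1" "norm (apply_bcontfun h t0) = 1"
      "\<And>t. apply_bcontfun h t = of_real (1 - \<delta>) * apply_bcontfun f t * (1 - \<psi> t) + v * \<psi> t"
    using lift[OF uv(1)] lift[OF uv(2)] by metis
  have "norm (apply_bcontfun (f - (1 / 2) *\<^sub>R (g + h)) t) \<le> 3 * \<delta>" for t
  proof -
    have "apply_bcontfun g t + apply_bcontfun h t =
        2 * (of_real (1 - \<delta>) * apply_bcontfun f t * (1 - \<psi> t)) + (u + v) * \<psi> t"
      by (simp add: gh algebra_simps)
    then have eq: "apply_bcontfun (f - (1 / 2) *\<^sub>R (g + h)) t =
        of_real \<delta> * apply_bcontfun f t + of_real (1 - \<delta>) * ((apply_bcontfun f t - a) * \<psi> t)"
      unfolding uv(3) by (simp add: scaleR_conv_of_real field_simps)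
    \<comment> \<open>In \<open>V\<close> the first factor is small by the choice of
      \<open>V\<close>; off \<open>V\<close> the second is small and the first is at most
      \<open>2\<close>.\<close>
    have "norm (apply_bcontfun f t - a) * norm (\<psi> t) \<le> 2 * \<delta>"
    proof (cases "t \<in> V")
      case True
      then have "norm (apply_bcontfun f t - a) * norm (\<psi> t) \<le> \<delta> * 1"
        using stolz_region_bounds(1)[OF \<psi>(3) \<delta>(1,2)] \<delta>
        by (intro mult_mono) (auto simp: V_def)
      then show ?thesis
        using \<delta> by simp
    next
      case False
      have "norm (apply_bcontfun f t - a) \<le> 2"
        using norm_triangle_ineq4[of "apply_bcontfun f t" a] f1[of t] f1[of t0] by (simp add: a_def)
      then show ?thesis
        using \<psi>(4)[OF False] by (intro mult_mono) auto
    qed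
    moreover have "norm (of_real \<delta> * apply_bcontfun f t) \<le> \<delta> * 1"
      unfolding norm_mult norm_of_real using \<delta> f1[of t] by (intro mult_mono) auto
    moreover have "norm (of_real (1 - \<delta>) * ((apply_bcontfun f t - a) * \<psi> t)) \<le>
        1 * (norm (apply_bcontfun f t - a) * norm (\<psi> t))"
      unfolding norm_mult norm_of_real using \<delta> by (intro mult_right_mono) auto
    ultimately show ?thesis
      unfolding eq by (intro norm_triangle_le) linarith
  qed
  then have "norm (f - (1 / 2) *\<^sub>R (g + h)) \<le> 3 * \<delta>"
    by (rule norm_bound)
  then show thesis
    using that[of g h] gh \<delta> by simp
qed

end

section \<open>The closed convex hull of the Delta-points\<close>

theorem corollary5p10:
  fixes A :: "('k::t2_space \<Rightarrow>\<^sub>C complex) set"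
  assumes "compact (UNIV :: 'k set)"
    and "uniform_algebra A"
    and "{t. strong_peak_point A t} \<inter> {t \<in> shilov_boundary A. t islimpt shilov_boundary A} \<noteq> {}"
  shows "convex_DLD2P A"
proof -
  interpret compact_uniform_algebra A
    using assms(1,2) by unfold_locales
  obtain t0 where t0: "strong_peak_point A t0" "t0 islimpt shilov_boundary A"
    using assms(3) by blast
  \<comment> \<open>A space with a limit point has a second point, as required to exclude the
    trivial peaking function.\<close>
  obtain t1 where "t1 \<noteq> t0"
    using t0(2) unfolding islimpt_def by blast
  obtain \<phi> where \<phi>: "\<phi> \<in> fun_algebra" "\<And>V. t0 \<in> V \<Longrightarrow> peaks_at_in \<phi> t0 V"
    using strong_peak_point_peaks[OF t0(1) \<open>t1 \<noteq> t0\<close>] by metis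
  define D where "D = {z. Delta_point A z}"
  have ball: "{z \<in> A. norm z \<le> 1} = A \<inter> cball 0 1"
    by (auto simp: dist_norm)
  have "closure (convex hull D) \<subseteq> A \<inter> cball 0 1"
  proof (intro closure_minimal hull_minimal)
    show "D \<subseteq> A \<inter> cball 0 1"
      by (auto simp: D_def Delta_point_def)
    show "convex (A \<inter> cball 0 1)"
      by (intro convex_Int convex_algebra convex_cball)
    show "closed (A \<inter> cball 0 1)"
      using algebra by (auto simp: uniform_algebra_def)
  qed
  moreover have "f \<in> closure (convex hull D)" if f: "f \<in> A" "norm f \<le> 1" for f
    unfolding closure_approachable
  proof (intro allI impI)
    fix \<epsilon> :: real assume "\<epsilon> > 0"
    obtain g h where gh: "g \<in> A" "h \<in> A" "norm g = 1" "norm h = 1"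
      "norm (apply_bcontfun g t0) = 1" "norm (apply_bcontfun h t0) = 1"
      "norm (f - (1 / 2) *\<^sub>R (g + h)) < \<epsilon>"
      by (rule average_of_functions_unimodular_at_peak[OF \<phi> f \<open>\<epsilon> > 0\<close>])
    \<comment> \<open>Both functions attain their norm at \<open>t0\<close>, which is a limit point
      of the Shilov boundary.\<close>
    have "g \<in> D" "h \<in> D"
      unfolding D_def using gh t0(2) by (auto intro: Delta_point_if_attains_at_limit_point)
    then have "(1 / 2) *\<^sub>R g + (1 / 2) *\<^sub>R h \<in> convex hull D"
      by (intro convexD convex_convex_hull hull_inc) auto
    then show "\<exists>y\<in>convex hull D. dist y f < \<epsilon>"
      using gh(7) by (intro bexI[of _ "(1 / 2) *\<^sub>R g + (1 / 2) *\<^sub>R h"])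
        (simp_all add: dist_norm norm_minus_commute scaleR_add_right)
  qed
  ultimately show ?thesis
    unfolding convex_DLD2P_def ball D_def[symmetric] by (auto simp: dist_norm)
qed

end
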